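(* Let $A$ be a positively graded finite-dimensional unital algebra over an algebraically closed field $K$ with $\Lambda_0\neq\emptyset$, and let $B=\operatorname{End}_A\bigl(\bigoplus_{\lambda\in\Lambda_0}P^\lambda\bigr)$. Assume that $\operatorname{soc}(P^\mu)\simeq L^\mu\langle d_\mu\rangle$ for each $\mu\in\Lambda_0$ and that $B$ has an admissible basis $\Upsilon$. Then the canonical form $\mathrm{tr}$ attached to $\Upsilon$ is a symmetrizing form on $B$. In particular, $B$ is a symmetric algebra over $K$.
   Context: Positively graded: $A=\bigoplus_{d\ge 0}A_d$ with $A_dA_k\subset A_{d+k}$. Graded modules are finite-dimensional and $\mathbb{Z}$-graded; $M\langle k\rangle_d:=M_{d-k}$; $\operatorname{Hom}_A(M,N)_d$ is the space of homomorphisms with $f(M_k)\subset N_{k+d}$ for all $k$, and $\operatorname{Hom}_A(M,N)=\bigoplus_d\operatorname{Hom}_A(M,N)_d$; $M\simeq N$ means there is a degree-0 isomorphism. $\{L^\lambda\mid\lambda\in\Lambda\}$ is a complete set of pairwise non-isomorphic simple $A$-modules, each graded by concentration in degree $0$. The projective cover $P^\lambda$ of $L^\lambda$ is graded so that the natural map $P^\lambda\to L^\lambda$ has degree $0$, and $P^\lambda=\bigoplus_{i=0}^{d_\lambda}P^\lambda_i$ with $P^\lambda_{d_\lambda}\ne0$; this defines $d_\lambda$. $\Lambda_0:=\{\lambda\in\Lambda\mid P^\lambda\text{ is injective}\}$. Then $B=\bigoplus_{\lambda,\mu\in\Lambda_0}\operatorname{Hom}_A(P^\lambda,P^\mu)$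 is positively graded. Under the socle assumption, for each $\lambda\in\Lambda_0$ fix $0\neq\theta_\lambda\in\operatorname{End}_A(P^\lambda)$ with image $\operatorname{soc}(P^\lambda)$ (unique up to scalar; homogeneous of degree $d_\lambda$). A $K$-basis $\Upsilon$ of $B$ is appropriate if $\{\theta_\lambda\mid\lambda\in\Lambda_0\}\subseteq\Upsilon\subseteq\bigsqcup_{\lambda,\mu\in\Lambda_0}\operatorname{Hom}_A(P^\lambda,P^\mu)$. An appropriate basis consisting of homogeneous elements is admissible if for all $\lambda,\mu\in\Lambda_0$ and $j\in\mathbb{Z}$ with $\Upsilon\cap\operatorname{Hom}_A(P^\lambda,P^\mu)_j\neq\emptyset$: (i) $d_\mu=d_\lambda$; (ii) $|\Upsilon\cap\operatorname{Hom}_A(P^\mu,P^\lambda)_{d_\lambda-j}|=|\Upsilon\cap\operatorname{Hom}_A(P^\lambda,P^\mu)_j|$; (iii) for any $f\in\Upsilon\cap\operatorname{Hom}_A(P^\lambda,P^\mu)_j$ there is exactly one $g\in\Upsilon\cap\operatorname{Hom}_A(P^\mu,P^\lambda)_{d_\lambda-j}$ such that $gf=c_{gf}\theta_\lambda$, $fg=c_{fg}\theta_\mu$ for some $c_{fg}=c_{gf}\in K^\times$, and $hf=fh=0$ for all $h\in\Upsilon\cap\operatorname{Hom}_A(P^\mu,P^\lambda)_{d_\lambda-j}$ with $h\ne g$. The canonical form attached to $\Upsilon$ is the linear map $\mathrm{tr}:B\to K$ with $\mathrm{tr}(\theta_\lambda)=1$ for all $\lambda\in\Lambda_0$ and $\mathrm{tr}(f)=0$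 for all other $f\in\Upsilon$. A symmetrizing form is a linear map $\tau:B\to K$ such that $(f,g)\mapsto\tau(fg)$ is symmetric and non-degenerate; $B$ is symmetric if it has a symmetrizing form. *)

theory Defs
  imports
    "HOL-Computational_Algebra.Polynomial"
    "HOL-Library.Function_Algebras"
begin

section \<open>Linear algebra\<close>

definition pointwise :: "('k \<Rightarrow> 'm \<Rightarrow> 'm) \<Rightarrow> 'k \<Rightarrow> ('x \<Rightarrow> 'm) \<Rightarrow> ('x \<Rightarrow> 'm)"
  where "pointwise s c f = (\<lambda>x. s c (f x))"

lemma vector_space_pointwise: "vector_space s \<Longrightarrow> vector_space (pointwise s)"
  by (auto simp: vector_space_def pointwise_def plus_fun_def)

definition internal_direct_sum :: "('i \<Rightarrow> 'm::ab_group_add set) \<Rightarrow> 'm set \<Rightarrow> bool"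
  where "internal_direct_sum C M \<longleftrightarrow>
    (\<forall>i. C i \<subseteq> M) \<and>
    (\<forall>x\<in>M. \<exists>!f. (\<forall>i. f i \<in> C i) \<and> finite {i. f i \<noteq> 0} \<and> x = (\<Sum>i | f i \<noteq> 0. f i))"

definition basis_of :: "('k::field \<Rightarrow> 'v::ab_group_add \<Rightarrow> 'v) \<Rightarrow> 'v set \<Rightarrow> 'v set \<Rightarrow> bool"
  where "basis_of s V U \<longleftrightarrow> \<not> module.dependent s U \<and> module.span s U = V"


section \<open>Algebras and modules\<close>

text \<open>
  \<open>sA\<close> is the action of the field on the algebra, whose underlying ring is the whole
  type \<open>'a\<close>.
\<close>

locale fd_algebra = vector_space sA
  for sA :: "'k::field \<Rightarrow> 'a::ring_1 \<Rightarrow> 'a" +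
  assumes mult_scale_left: "sA c x * y = sA c (x * y)"
    and mult_scale_right: "x * sA c y = sA c (x * y)"
    and finite_dim: "\<exists>F. finite F \<and> module.span sA F = UNIV"

locale positively_graded_algebra = fd_algebra sA
  for sA :: "'k::field \<Rightarrow> 'a::ring_1 \<Rightarrow> 'a" +
  fixes A :: "nat \<Rightarrow> 'a set"
  assumes subspace_component: "module.subspace sA (A d)"
    and direct_sum: "internal_direct_sum A UNIV"
    and mult_component: "\<lbrakk>x \<in> A d; y \<in> A k\<rbrakk> \<Longrightarrow> x * y \<in> A (d + k)"

text \<open>
  Families of modules indexed by a set are needed, so the underlying space of a left module is
  a subspace \<open>carrier M\<close> of an ambient vector space, given by a type \<open>'m\<close> with scalar
  multiplication \<open>sM\<close>. Nothing is required of \<open>act M a\<close> outside \<open>carrier M\<close>.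
  The homogeneous component of degree \<open>k\<close> of a graded module is \<open>gr M k\<close>.
\<close>

record ('a, 'm) amod =
  carrier :: "'m set"
  act :: "'a \<Rightarrow> 'm \<Rightarrow> 'm"

record ('a, 'm) gmod = "('a, 'm) amod" +
  gr :: "int \<Rightarrow> 'm set"

locale fd_module = alg: fd_algebra sA + V: vector_space sM
  for sA :: "'k::field \<Rightarrow> 'a::ring_1 \<Rightarrow> 'a"
    and sM :: "'k \<Rightarrow> 'm::ab_group_add \<Rightarrow> 'm" +
  fixes M :: "('a, 'm, 'z) amod_scheme"
  assumes act_closed: "x \<in> carrier M \<Longrightarrow> act M a x \<in> carrier M"
    and act_add_right: "\<lbrakk>x \<in> carrier M; y \<in> carrier M\<rbrakk> \<Longrightarrow> act M a (x + y) = act M a x + act M a y"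
    and act_add_left: "x \<in> carrier M \<Longrightarrow> act M (a + b) x = act M a x + act M b x"
    and act_mult: "x \<in> carrier M \<Longrightarrow> act M (a * b) x = act M a (act M b x)"
    and act_one: "x \<in> carrier M \<Longrightarrow> act M 1 x = x"
    and act_scale: "x \<in> carrier M \<Longrightarrow> act M (sA c a) x = sM c (act M a x)"
    and finite_dim_carrier: "\<exists>F. finite F \<and> V.span F = carrier M"

locale graded_module = alg: positively_graded_algebra sA A + fd_module sA sM M
  for sA :: "'k::field \<Rightarrow> 'a::ring_1 \<Rightarrow> 'a"
    and A :: "nat \<Rightarrow> 'a set"
    and sM :: "'k \<Rightarrow> 'm::ab_group_add \<Rightarrow> 'm"
    and M :: "('a, 'm) gmod" +
  assumes subspace_gr: "V.subspace (gr M k)"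
    and direct_sum_gr: "internal_direct_sum (gr M) (carrier M)"
    and act_gr: "\<lbrakk>a \<in> A d; x \<in> gr M k\<rbrakk> \<Longrightarrow> act M a x \<in> gr M (int d + k)"

definition shift :: "('a, 'm) gmod \<Rightarrow> int \<Rightarrow> ('a, 'm) gmod"
  where "shift M k = M\<lparr>gr := \<lambda>d. gr M (d - k)\<rparr>"

definition top_degree :: "('a, 'm::zero) gmod \<Rightarrow> int"
  where "top_degree M = Max {i. gr M i \<noteq> {0}}"

definition submodule :: "('a, 'm::ab_group_add, 'z) amod_scheme \<Rightarrow> 'm set \<Rightarrow> bool"
  where "submodule M S \<longleftrightarrow>
    S \<subseteq> carrier M \<and> 0 \<in> S \<and> (\<forall>x\<in>S. \<forall>y\<in>S. x + y \<in> S) \<and> (\<forall>a. \<forall>x\<in>S. act M a x \<in> S)"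

definition simple_module :: "('a, 'm::ab_group_add, 'z) amod_scheme \<Rightarrow> bool"
  where "simple_module M \<longleftrightarrow>
    carrier M \<noteq> {0} \<and> (\<forall>S. submodule M S \<longrightarrow> S = {0} \<or> S = carrier M)"

definition soc :: "('k::field \<Rightarrow> 'm::ab_group_add \<Rightarrow> 'm) \<Rightarrow> ('a, 'm, 'z) amod_scheme \<Rightarrow> 'm set"
  where "soc sM M = module.span sM (\<Union>{S. submodule M S \<and> simple_module (M\<lparr>carrier := S\<rparr>)})"

definition graded_soc ::
    "('k::field \<Rightarrow> 'm::ab_group_add \<Rightarrow> 'm) \<Rightarrow> ('a, 'm) gmod \<Rightarrow> ('a, 'm) gmod"
  where "graded_soc sM M = M\<lparr>carrier := soc sM M, gr := \<lambda>d. gr M d \<inter> soc sM M\<rparr>"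


section \<open>Homomorphisms\<close>

text \<open>
  A homomorphism is represented by its extension by zero outside the carrier of its source.
  The representatives form a subspace of the function space, and composition of homomorphisms
  is \<open>\<circ>\<close>; the identity of \<open>M\<close> is represented by \<open>\<lambda>x. if x \<in> carrier M then x else 0\<close>.
\<close>

definition module_Hom ::
    "('a, 'm::ab_group_add, 'y) amod_scheme \<Rightarrow> ('a, 'n::ab_group_add, 'z) amod_scheme
      \<Rightarrow> ('m \<Rightarrow> 'n) set"
  where "module_Hom M N = {f.
    (\<forall>x\<in>carrier M. f x \<in> carrier N) \<and>
    (\<forall>x\<in>carrier M. \<forall>y\<in>carrier M. f (x + y) = f x + f y) \<and>
    (\<forall>a. \<forall>x\<in>carrier M. f (act M a x) = act N a (f x)) \<and>
    (\<forall>x. x \<notin> carrier M \<longrightarrow> f x = 0)}"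

definition graded_Hom ::
    "('a, 'm::ab_group_add) gmod \<Rightarrow> ('a, 'n::ab_group_add) gmod \<Rightarrow> int \<Rightarrow> ('m \<Rightarrow> 'n) set"
  where "graded_Hom M N d = {f \<in> module_Hom M N. \<forall>k. f ` gr M k \<subseteq> gr N (k + d)}"

definition module_iso ::
    "('a, 'm::ab_group_add, 'y) amod_scheme \<Rightarrow> ('a, 'n::ab_group_add, 'z) amod_scheme \<Rightarrow> bool"
  where "module_iso M N \<longleftrightarrow> (\<exists>f\<in>module_Hom M N. bij_betw f (carrier M) (carrier N))"

definition graded_iso ::
    "('a, 'm::ab_group_add) gmod \<Rightarrow> ('a, 'n::ab_group_add) gmod \<Rightarrow> bool"
  where "graded_iso M N \<longleftrightarrow> (\<exists>f\<in>graded_Hom M N 0. bij_betw f (carrier M) (carrier N))"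


section \<open>Simple, projective and injective modules\<close>

text \<open>
  The definitions below quantify over all finite-dimensional modules. HOL cannot quantify over
  types inside a formula, so these are taken with carriers in the space \<open>nat \<Rightarrow> 'k\<close> of
  sequences of scalars: it has subspaces of every finite dimension, so every finite-dimensional
  module over the algebra is isomorphic to one of this kind.
\<close>

abbreviation seq_scale :: "'k::field \<Rightarrow> (nat \<Rightarrow> 'k) \<Rightarrow> (nat \<Rightarrow> 'k)"
  where "seq_scale \<equiv> pointwise (*)"

definition projective_module ::
    "('k::field \<Rightarrow> 'a::ring_1 \<Rightarrow> 'a) \<Rightarrow> ('a, 'm::ab_group_add, 'z) amod_scheme \<Rightarrow> bool"
  where "projective_module sA P \<longleftrightarrow>
    (\<forall>(M :: ('a, nat \<Rightarrow> 'k) amod) (N :: ('a, nat \<Rightarrow> 'k) amod).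
      fd_module sA seq_scale M \<and> fd_module sA seq_scale N \<longrightarrow>
      (\<forall>g\<in>module_Hom M N. \<forall>f\<in>module_Hom P N. g ` carrier M = carrier N \<longrightarrow>
        (\<exists>h\<in>module_Hom P M. g \<circ> h = f)))"

definition injective_module ::
    "('k::field \<Rightarrow> 'a::ring_1 \<Rightarrow> 'a) \<Rightarrow> ('a, 'm::ab_group_add, 'z) amod_scheme \<Rightarrow> bool"
  where "injective_module sA I \<longleftrightarrow>
    (\<forall>(M :: ('a, nat \<Rightarrow> 'k) amod) (N :: ('a, nat \<Rightarrow> 'k) amod).
      fd_module sA seq_scale M \<and> fd_module sA seq_scale N \<longrightarrow>
      (\<forall>g\<in>module_Hom M N. \<forall>f\<in>module_Hom M I. inj_on g (carrier M) \<longrightarrow>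
        (\<exists>h\<in>module_Hom N I. h \<circ> g = f)))"

text \<open>The covering map is surjective with superfluous kernel and has degree 0.\<close>

definition graded_projective_cover ::
    "('k::field \<Rightarrow> 'a::ring_1 \<Rightarrow> 'a) \<Rightarrow> ('a, 'p::ab_group_add) gmod \<Rightarrow> ('a, 'q::ab_group_add) gmod
      \<Rightarrow> bool"
  where "graded_projective_cover sA P L \<longleftrightarrow>
    projective_module sA P \<and>
    (\<exists>\<pi>\<in>graded_Hom P L 0.
      \<pi> ` carrier P = carrier L \<and>
      (\<forall>S. submodule P S \<and> {s + y | s y. s \<in> S \<and> y \<in> carrier P \<and> \<pi> y = 0} = carrier P
        \<longrightarrow> S = carrier P))"

definition concentrated_in_degree_0 :: "('a, 'm::ab_group_add) gmod \<Rightarrow> bool"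
  where "concentrated_in_degree_0 M \<longleftrightarrow> gr M 0 = carrier M \<and> (\<forall>k. k \<noteq> 0 \<longrightarrow> gr M k = {0})"

definition complete_set_of_simples ::
    "('k::field \<Rightarrow> 'a::ring_1 \<Rightarrow> 'a) \<Rightarrow> 'l set \<Rightarrow> ('l \<Rightarrow> ('a, 'q::ab_group_add) gmod) \<Rightarrow> bool"
  where "complete_set_of_simples sA \<Lambda> L \<longleftrightarrow>
    (\<forall>l\<in>\<Lambda>. simple_module (L l)) \<and>
    (\<forall>l\<in>\<Lambda>. \<forall>m\<in>\<Lambda>. module_iso (L l) (L m) \<longrightarrow> l = m) \<and>
    (\<forall>S :: ('a, nat \<Rightarrow> 'k) amod. fd_module sA seq_scale S \<and> simple_module S \<longrightarrow>
      (\<exists>l\<in>\<Lambda>. module_iso S (L l)))"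

definition injective_indices ::
    "('k::field \<Rightarrow> 'a::ring_1 \<Rightarrow> 'a) \<Rightarrow> 'l set \<Rightarrow> ('l \<Rightarrow> ('a, 'p::ab_group_add) gmod) \<Rightarrow> 'l set"
  where "injective_indices sA \<Lambda> P = {l \<in> \<Lambda>. injective_module sA (P l)}"


section \<open>The endomorphism algebra of a direct sum\<close>

definition dsum :: "'l set \<Rightarrow> ('l \<Rightarrow> ('a, 'p::ab_group_add) gmod) \<Rightarrow> ('a, 'l \<Rightarrow> 'p) amod"
  where "dsum I P = \<lparr>
    carrier = {x. (\<forall>l\<in>I. x l \<in> carrier (P l)) \<and> (\<forall>l. l \<notin> I \<longrightarrow> x l = 0) \<and> finite {l. x l \<noteq> 0}},
    act = (\<lambda>a x l. if l \<in> I then act (P l) a (x l) else 0)\<rparr>"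

definition End_dsum ::
    "'l set \<Rightarrow> ('l \<Rightarrow> ('a, 'p::ab_group_add) gmod) \<Rightarrow> (('l \<Rightarrow> 'p) \<Rightarrow> ('l \<Rightarrow> 'p)) set"
  where "End_dsum I P = module_Hom (dsum I P) (dsum I P)"

abbreviation End_scale ::
    "('k \<Rightarrow> 'p \<Rightarrow> 'p) \<Rightarrow> 'k \<Rightarrow> (('l \<Rightarrow> 'p) \<Rightarrow> ('l \<Rightarrow> 'p)) \<Rightarrow> (('l \<Rightarrow> 'p) \<Rightarrow> ('l \<Rightarrow> 'p))"
  where "End_scale sP \<equiv> pointwise (pointwise sP)"

text \<open>
  \<open>block I P l m f\<close> is the image of \<open>f : P l \<rightarrow> P m\<close> in the endomorphism algebra of the direct
  sum: project to the summand \<open>l\<close>, apply \<open>f\<close>, include the summand \<open>m\<close>. \<open>Hom_block\<close> and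
  \<open>Hom_block_deg\<close> are the images of \<open>Hom (P l) (P m)\<close> and of its part of degree \<open>j\<close>.
\<close>

definition block ::
    "'l set \<Rightarrow> ('l \<Rightarrow> ('a, 'p::ab_group_add) gmod) \<Rightarrow> 'l \<Rightarrow> 'l \<Rightarrow> ('p \<Rightarrow> 'p)
      \<Rightarrow> ('l \<Rightarrow> 'p) \<Rightarrow> ('l \<Rightarrow> 'p)"
  where "block I P l m f = (\<lambda>x n. if x \<in> carrier (dsum I P) \<and> n = m then f (x l) else 0)"

definition Hom_block ::
    "'l set \<Rightarrow> ('l \<Rightarrow> ('a, 'p::ab_group_add) gmod) \<Rightarrow> 'l \<Rightarrow> 'l \<Rightarrow> (('l \<Rightarrow> 'p) \<Rightarrow> ('l \<Rightarrow> 'p)) set"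
  where "Hom_block I P l m = block I P l m ` module_Hom (P l) (P m)"

definition Hom_block_deg ::
    "'l set \<Rightarrow> ('l \<Rightarrow> ('a, 'p::ab_group_add) gmod) \<Rightarrow> 'l \<Rightarrow> 'l \<Rightarrow> int
      \<Rightarrow> (('l \<Rightarrow> 'p) \<Rightarrow> ('l \<Rightarrow> 'p)) set"
  where "Hom_block_deg I P l m j = block I P l m ` graded_Hom (P l) (P m) j"


section \<open>Admissible bases and the canonical form\<close>

text \<open>
  \<open>\<theta> l\<close> is an endomorphism of \<open>P l\<close>; \<open>\<Theta> I P \<theta> l\<close> is the same map seen in the endomorphism
  algebra of the direct sum.
\<close>

abbreviation \<Theta> ::
    "'l set \<Rightarrow> ('l \<Rightarrow> ('a, 'p::ab_group_add) gmod) \<Rightarrow> ('l \<Rightarrow> 'p \<Rightarrow> 'p) \<Rightarrow> 'l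
      \<Rightarrow> ('l \<Rightarrow> 'p) \<Rightarrow> ('l \<Rightarrow> 'p)"
  where "\<Theta> I P \<theta> l \<equiv> block I P l l (\<theta> l)"

definition appropriate_basis ::
    "('k::field \<Rightarrow> 'p::ab_group_add \<Rightarrow> 'p) \<Rightarrow> 'l set \<Rightarrow> ('l \<Rightarrow> ('a, 'p) gmod) \<Rightarrow> ('l \<Rightarrow> 'p \<Rightarrow> 'p)
      \<Rightarrow> (('l \<Rightarrow> 'p) \<Rightarrow> ('l \<Rightarrow> 'p)) set \<Rightarrow> bool"
  where "appropriate_basis sP I P \<theta> \<Upsilon> \<longleftrightarrow>
    basis_of (End_scale sP) (End_dsum I P) \<Upsilon> \<and>
    \<Theta> I P \<theta> ` I \<subseteq> \<Upsilon> \<and>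
    \<Upsilon> \<subseteq> (\<Union>l\<in>I. \<Union>m\<in>I. Hom_block I P l m)"

definition admissible_basis ::
    "('k::field \<Rightarrow> 'p::ab_group_add \<Rightarrow> 'p) \<Rightarrow> 'l set \<Rightarrow> ('l \<Rightarrow> ('a, 'p) gmod) \<Rightarrow> ('l \<Rightarrow> 'p \<Rightarrow> 'p)
      \<Rightarrow> (('l \<Rightarrow> 'p) \<Rightarrow> ('l \<Rightarrow> 'p)) set \<Rightarrow> bool"
  where "admissible_basis sP I P \<theta> \<Upsilon> \<longleftrightarrow>
    appropriate_basis sP I P \<theta> \<Upsilon> \<and>
    \<Upsilon> \<subseteq> (\<Union>l\<in>I. \<Union>m\<in>I. \<Union>j. Hom_block_deg I P l m j) \<and>
    (\<forall>l\<in>I. \<forall>m\<in>I. \<forall>j. \<Upsilon> \<inter> Hom_block_deg I P l m j \<noteq> {} \<longrightarrow>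
      top_degree (P m) = top_degree (P l) \<and>
      card (\<Upsilon> \<inter> Hom_block_deg I P m l (top_degree (P l) - j))
        = card (\<Upsilon> \<inter> Hom_block_deg I P l m j) \<and>
      (\<forall>f \<in> \<Upsilon> \<inter> Hom_block_deg I P l m j.
        \<exists>!g. g \<in> \<Upsilon> \<inter> Hom_block_deg I P m l (top_degree (P l) - j) \<and>
          (\<exists>c. c \<noteq> 0 \<and> g \<circ> f = End_scale sP c (\<Theta> I P \<theta> l) \<and>
                       f \<circ> g = End_scale sP c (\<Theta> I P \<theta> m)) \<and>
          (\<forall>h \<in> \<Upsilon> \<inter> Hom_block_deg I P m l (top_degree (P l) - j).
            h \<noteq> g \<longrightarrow> h \<circ> f = 0 \<and> f \<circ> h = 0)))"

text \<open>
  \<open>construct\<close> extends the given values on an independent set linearly. The resulting functional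
  is defined on the whole function space containing the endomorphism algebra; only its
  restriction to the span of \<open>\<Upsilon>\<close> matters.
\<close>

definition canonical_form ::
    "('k::field \<Rightarrow> 'p::ab_group_add \<Rightarrow> 'p) \<Rightarrow> 'l set \<Rightarrow> ('l \<Rightarrow> ('a, 'p) gmod) \<Rightarrow> ('l \<Rightarrow> 'p \<Rightarrow> 'p)
      \<Rightarrow> (('l \<Rightarrow> 'p) \<Rightarrow> ('l \<Rightarrow> 'p)) set \<Rightarrow> (('l \<Rightarrow> 'p) \<Rightarrow> ('l \<Rightarrow> 'p)) \<Rightarrow> 'k"
  where "canonical_form sP I P \<theta> \<Upsilon> =
    vector_space_pair.construct (End_scale sP) (*) \<Upsilon> (\<lambda>f. if f \<in> \<Theta> I P \<theta> ` I then 1 else 0)"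

lemma canonical_form_linear:
  assumes "vector_space sP" and "appropriate_basis sP I P \<theta> \<Upsilon>"
  shows "Vector_Spaces.linear (End_scale sP) (*) (canonical_form sP I P \<theta> \<Upsilon>)"
proof -
  interpret vector_space_pair "End_scale sP" "(*)"
    using assms(1) by (simp add: vector_space_pair_def vector_space_pointwise)
      (simp add: vector_space_def algebra_simps)
  show ?thesis
    unfolding canonical_form_def
    using assms(2) by (intro linear_construct) (simp add: appropriate_basis_def basis_of_def)
qed

lemma canonical_form_on_basis:
  assumes "vector_space sP" and "appropriate_basis sP I P \<theta> \<Upsilon>" and "f \<in> \<Upsilon>"
  shows "canonical_form sP I P \<theta> \<Upsilon> f = (if f \<in> \<Theta> I P \<theta> ` I then 1 else 0)"
proof -
  interpret vector_space_pair "End_scale sP" "(*)"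
    using assms(1) by (simp add: vector_space_pair_def vector_space_pointwise)
      (simp add: vector_space_def algebra_simps)
  show ?thesis
    unfolding canonical_form_def
    using assms(2,3) by (intro construct_basis) (simp_all add: appropriate_basis_def basis_of_def)
qed


section \<open>Symmetric algebras\<close>

text \<open>
  The algebra has underlying set \<open>B\<close>, scalar multiplication \<open>s\<close> and product \<open>bmul\<close>.
\<close>

definition symmetrizing_form ::
    "('k::field \<Rightarrow> 'b::ab_group_add \<Rightarrow> 'b) \<Rightarrow> 'b set \<Rightarrow> ('b \<Rightarrow> 'b \<Rightarrow> 'b) \<Rightarrow> ('b \<Rightarrow> 'k) \<Rightarrow> bool"
  where "symmetrizing_form s B bmul \<tau> \<longleftrightarrow>
    (\<forall>f\<in>B. \<forall>g\<in>B. \<tau> (f + g) = \<tau> f + \<tau> g) \<and>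
    (\<forall>c. \<forall>f\<in>B. \<tau> (s c f) = c * \<tau> f) \<and>
    (\<forall>f\<in>B. \<forall>g\<in>B. \<tau> (bmul f g) = \<tau> (bmul g f)) \<and>
    (\<forall>f\<in>B. (\<forall>g\<in>B. \<tau> (bmul f g) = 0) \<longrightarrow> f = 0) \<and>
    (\<forall>g\<in>B. (\<forall>f\<in>B. \<tau> (bmul f g) = 0) \<longrightarrow> g = 0)"

definition symmetric_algebra ::
    "('k::field \<Rightarrow> 'b::ab_group_add \<Rightarrow> 'b) \<Rightarrow> 'b set \<Rightarrow> ('b \<Rightarrow> 'b \<Rightarrow> 'b) \<Rightarrow> bool"
  where "symmetric_algebra s B bmul \<longleftrightarrow> (\<exists>\<tau>. symmetrizing_form s B bmul \<tau>)"

end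

theory Submission
  imports Defs
begin

text \<open>
  Composition adds degrees, the blocks \<open>Hom (P l) (P m)\<close> of fixed degree are linearly independent,
  and \<open>\<theta>\<^sub>l\<close> is homogeneous of degree \<open>d\<^sub>l\<close> because its own partner \<open>g\<close> satisfies
  \<open>g \<theta>\<^sub>l = c \<theta>\<^sub>l\<close> with \<open>c \<noteq> 0\<close>. Hence \<open>tr\<close> kills every homogeneous element
  that is not an endomorphism of some \<open>P l\<close> of degree \<open>d\<^sub>l\<close>. For basis elements \<open>f\<close> of degree
  \<open>j\<close> and \<open>g\<close>, both \<open>tr (f g)\<close> and \<open>tr (g f)\<close> therefore vanish unless \<open>g\<close> goes the opposite way in
  the complementary degree \<open>d\<^sub>l - j\<close>, where the partner condition shows that they are equal, and
  nonzero exactly for the partner. The Gram matrix of the form in \<open>\<Upsilon>\<close> is thus symmetric and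
  monomial with invertible entries.
\<close>

section \<open>Pointwise sums and the value of a homomorphism at zero\<close>

lemma sum_fun_apply: "(\<Sum>t\<in>T. h t) x = (\<Sum>t\<in>T. h t x)"
  by (induction T rule: infinite_finite_induct) auto

lemma module_Hom_zero:
  assumes "f \<in> module_Hom M N" "0 \<in> carrier M"
  shows "f 0 = (0 :: 'n::ab_group_add)"
proof -
  have "f (0 + 0) = f 0 + f 0"
    using assms unfolding module_Hom_def by blast
  then show ?thesis by simp
qed

section \<open>Scalars acting through the algebra\<close>

context fd_module
begin

lemma subspace_carrier: "V.subspace (carrier M)"
  using finite_dim_carrier V.subspace_span by metis

text \<open>\<open>module_Hom\<close> asks only for additivity and compatibility with the algebra.
  Since a scalar \<open>c\<close> acts as the algebra element \<open>sA c 1\<close>, linearity over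
  the field comes for free.\<close>

lemma act_scalar: "x \<in> carrier M \<Longrightarrow> act M (sA c 1) x = sM c x"
  by (simp add: act_scale act_one)

text \<open>Writing \<open>c\<close> as the central element \<open>sA c 1\<close> lets it pass
  through \<open>a\<close>.\<close>

lemma act_scale_right:
  assumes "x \<in> carrier M"
  shows "act M a (sM c x) = sM c (act M a x)"
proof -
  have "act M a (sM c x) = act M (a * sA c 1) x"
    using assms by (simp add: act_mult act_scalar)
  also have "\<dots> = sM c (act M a x)"
    using assms by (simp add: alg.mult_scale_right act_scale)
  finally show ?thesis .
qed

end

section \<open>Homogeneous components in a graded module\<close>

context graded_module
begin

lemma gr_subset: "gr M k \<subseteq> carrier M"
  using direct_sum_gr unfolding internal_direct_sum_def by blast

text \<open>\<open>THE\<close> determines the decomposition only for \<open>x\<close> in the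
  carrier, where \<open>direct_sum_gr\<close> supplies existence and uniqueness.\<close>

definition homogeneous_components :: "'m \<Rightarrow> int \<Rightarrow> 'm" where
  "homogeneous_components x =
    (THE f. (\<forall>i. f i \<in> gr M i) \<and> finite {i. f i \<noteq> 0} \<and> x = (\<Sum>i | f i \<noteq> 0. f i))"

lemma homogeneous_components_ex1:
  "x \<in> carrier M \<Longrightarrow>
    \<exists>!f. (\<forall>i. f i \<in> gr M i) \<and> finite {i. f i \<noteq> 0} \<and> x = (\<Sum>i | f i \<noteq> 0. f i)"
  using direct_sum_gr unfolding internal_direct_sum_def by blast

lemma homogeneous_components:
  assumes "x \<in> carrier M"
  shows "homogeneous_components x i \<in> gr M i"
    and "finite {i. homogeneous_components x i \<noteq> 0}"
    and "x = (\<Sum>i | homogeneous_components x i \<noteq> 0. homogeneous_components x i)"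
  using theI'[OF homogeneous_components_ex1[OF assms]]
  unfolding homogeneous_components_def[symmetric] by auto

text \<open>\<open>S\<close> may be larger than the support, so several elements can be decomposed
  over one common index set.\<close>

lemma homogeneous_components_eq:
  assumes "\<And>i. f i \<in> gr M i" "finite S" "{i. f i \<noteq> 0} \<subseteq> S"
  shows "homogeneous_components (\<Sum>i\<in>S. f i) = f"
proof -
  have x: "(\<Sum>i\<in>S. f i) \<in> carrier M"
    using gr_subset assms(1) by (intro V.subspace_sum subspace_carrier) blast
  have "(\<Sum>i\<in>S. f i) = (\<Sum>i | f i \<noteq> 0. f i)"
    using assms(2,3) by (intro sum.mono_neutral_right) auto
  then show ?thesis
    unfolding homogeneous_components_def using assms
    by (intro the1_equality homogeneous_components_ex1 x) (auto intro: finite_subset)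
qed

lemma homogeneous_components_homogeneous:
  assumes "x \<in> gr M d"
  shows "homogeneous_components x k = (if k = d then x else 0)"
proof -
  have "homogeneous_components (\<Sum>i\<in>{d}. if i = d then x else 0) = (\<lambda>i. if i = d then x else 0)"
    by (rule homogeneous_components_eq) (use assms V.subspace_0[OF subspace_gr] in auto)
  then show ?thesis by simp
qed

lemma homogeneous_components_add:
  assumes "x \<in> carrier M" "y \<in> carrier M"
  shows "homogeneous_components (x + y) =
    (\<lambda>i. homogeneous_components x i + homogeneous_components y i)"
proof -
  note hx = homogeneous_components[OF assms(1)] and hy = homogeneous_components[OF assms(2)]
  \<comment> \<open>The union of the two supports serves both sums. Cancellation may shrink the
    support of \<open>x + y\<close>, which \<open>homogeneous_components_eq\<close> permits.\<close>
  let ?S = "{i. homogeneous_components x i \<noteq> 0} \<union> {i. homogeneous_components y i \<noteq> 0}"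
  have fin: "finite ?S" using hx(2) hy(2) by simp
  have "x = (\<Sum>i\<in>?S. homogeneous_components x i)"
    by (subst hx(3), rule sum.mono_neutral_left) (use fin in auto)
  moreover have "y = (\<Sum>i\<in>?S. homogeneous_components y i)"
    by (subst hy(3), rule sum.mono_neutral_left) (use fin in auto)
  ultimately have xy: "x + y = (\<Sum>i\<in>?S. homogeneous_components x i + homogeneous_components y i)"
    by (simp add: sum.distrib)
  show ?thesis
    unfolding xy by (rule homogeneous_components_eq)
      (use fin hx(1) hy(1) V.subspace_add[OF subspace_gr] in auto)
qed

lemma homogeneous_components_sum:
  assumes "\<And>t. t \<in> T \<Longrightarrow> h t \<in> carrier M"
  shows "homogeneous_components (\<Sum>t\<in>T. h t) d = (\<Sum>t\<in>T. homogeneous_components (h t) d)"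
  using assms
proof (induction T rule: infinite_finite_induct)
  case (insert t T)
  then have "(\<Sum>t\<in>T. h t) \<in> carrier M"
    by (intro V.subspace_sum subspace_carrier) auto
  then show ?case using insert by (simp add: homogeneous_components_add)
qed (use homogeneous_components_homogeneous[OF V.subspace_0[OF subspace_gr]] in auto)

lemma module_Hom_sum:
  assumes "f \<in> module_Hom M N" "\<And>t. t \<in> T \<Longrightarrow> h t \<in> carrier M"
  shows "f (\<Sum>t\<in>T. h t) = (\<Sum>t\<in>T. f (h t))"
  using assms(2)
proof (induction T rule: infinite_finite_induct)
  case (insert t T)
  then have "(\<Sum>t\<in>T. h t) \<in> carrier M"
    by (intro V.subspace_sum subspace_carrier) auto
  then show ?case using insert assms(1) by (simp add: module_Hom_def)
qed (use module_Hom_zero[OF assms(1) V.subspace_0[OF subspace_carrier]] in auto)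

text \<open>Additivity extends the vanishing from homogeneous elements to the carrier, and a
  representative is 0 off the carrier by convention.\<close>

lemma module_Hom_eq_0_if_gr:
  assumes f: "f \<in> module_Hom M N" and "\<And>k y. y \<in> gr M k \<Longrightarrow> f y = 0"
  shows "f = 0"
proof
  fix x show "f x = 0 x"
  proof (cases "x \<in> carrier M")
    case True
    have "f x = (\<Sum>i | homogeneous_components x i \<noteq> 0. f (homogeneous_components x i))"
      by (subst homogeneous_components(3)[OF True], rule module_Hom_sum[OF f])
        (use homogeneous_components(1)[OF True] gr_subset in blast)
    also have "\<dots> = 0"
      using assms(2)[OF homogeneous_components(1)[OF True]] by (intro sum.neutral) auto
    finally show ?thesis by simp
  qed (use f in \<open>simp add: module_Hom_def\<close>)
qed

end

section \<open>Endomorphisms of a direct sum of graded modules\<close>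

locale graded_module_family = vector_space sP
  for sP :: "'k::field \<Rightarrow> 'p::ab_group_add \<Rightarrow> 'p" +
  fixes sA :: "'k \<Rightarrow> 'a::ring_1 \<Rightarrow> 'a" and A :: "nat \<Rightarrow> 'a set"
    and I :: "'l set" and P :: "'l \<Rightarrow> ('a, 'p) gmod"
  assumes graded_module: "l \<in> I \<Longrightarrow> graded_module sA A sP (P l)"
begin

sublocale E: vector_space "End_scale sP"
  by (intro vector_space_pointwise) unfold_locales

abbreviation "D \<equiv> carrier (dsum I P)"
abbreviation "H \<equiv> Hom_block_deg I P"
text \<open>The inclusion of the summand \<open>l\<close>. It yields test vectors that isolate the
  blocks with source \<open>l\<close>.\<close>

abbreviation "single l y \<equiv> (\<lambda>n. if n = l then y else 0)"

lemma subspace_carrier: "l \<in> I \<Longrightarrow> subspace (carrier (P l))"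
  using graded_module by (meson fd_module.subspace_carrier graded_module.axioms(2))

text \<open>A block feeds one coordinate of its argument to the map, so a vanishing coordinate has
  to have a vanishing image.\<close>

lemma graded_Hom_zero: "f \<in> graded_Hom (P l) (P m) j \<Longrightarrow> l \<in> I \<Longrightarrow> f 0 = 0"
  using module_Hom_zero[of f "P l" "P m"] subspace_0[OF subspace_carrier]
  by (auto simp: graded_Hom_def)

lemma single_in_dsum: "l \<in> I \<Longrightarrow> y \<in> carrier (P l) \<Longrightarrow> single l y \<in> D"
  using subspace_0[OF subspace_carrier] by (auto simp: dsum_def)

lemma in_dsumD: "x \<in> D \<Longrightarrow> l \<in> I \<Longrightarrow> x l \<in> carrier (P l)"
  by (simp add: dsum_def)

lemma act_dsum_scalar:
  assumes "x \<in> D" shows "act (dsum I P) (sA c 1) x = pointwise sP c x"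
proof
  fix l
  show "act (dsum I P) (sA c 1) x l = pointwise sP c x l"
  proof (cases "l \<in> I")
    case True
    interpret M: graded_module sA A sP "P l" by (rule graded_module[OF True])
    show ?thesis using True M.act_scalar[OF in_dsumD[OF assms True]]
      by (simp add: dsum_def pointwise_def)
  next
    case False
    then show ?thesis using assms by (simp add: dsum_def pointwise_def)
  qed
qed

lemma End_dsum_closed: "f \<in> End_dsum I P \<Longrightarrow> x \<in> D \<Longrightarrow> f x \<in> D"
  by (simp add: End_dsum_def module_Hom_def)

lemma End_dsum_outside: "f \<in> End_dsum I P \<Longrightarrow> x \<notin> D \<Longrightarrow> f x = 0"
  by (simp add: End_dsum_def module_Hom_def)

lemma zero_in_dsum: "0 \<in> D"
  using subspace_0[OF subspace_carrier] by (auto simp: dsum_def)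

lemma End_dsum_zero: "f \<in> End_dsum I P \<Longrightarrow> f 0 = 0"
  using module_Hom_zero zero_in_dsum by (auto simp: End_dsum_def)

text \<open>Scaling by \<open>c\<close> is the action of \<open>sA c 1\<close>, with which every
  endomorphism commutes.\<close>

lemma End_dsum_scale:
  assumes "f \<in> End_dsum I P" "x \<in> D"
  shows "f (pointwise sP c x) = pointwise sP c (f x)"
proof -
  have "f (act (dsum I P) (sA c 1) x) = act (dsum I P) (sA c 1) (f x)"
    using assms by (simp add: End_dsum_def module_Hom_def)
  then show ?thesis
    using act_dsum_scalar assms End_dsum_closed by simp
qed

lemma End_dsum_comp:
  assumes "f \<in> End_dsum I P" "g \<in> End_dsum I P"
  shows "f \<circ> g \<in> End_dsum I P"
  using assms End_dsum_zero[OF assms(1)] by (auto simp: End_dsum_def module_Hom_def)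

text \<open>Additivity of \<open>f\<close> is available on \<open>D\<close> only; outside
  \<open>D\<close> both sides reduce to \<open>f 0 = 0\<close>.\<close>

lemma comp_add_right:
  assumes "f \<in> End_dsum I P" "g \<in> End_dsum I P" "h \<in> End_dsum I P"
  shows "f \<circ> (g + h) = (f \<circ> g) + (f \<circ> h)"
proof
  fix x show "(f \<circ> (g + h)) x = ((f \<circ> g) + (f \<circ> h)) x"
  proof (cases "x \<in> D")
    case True
    then have "g x \<in> D" "h x \<in> D" using assms End_dsum_closed by auto
    then show ?thesis using assms(1) by (simp add: End_dsum_def module_Hom_def)
  next
    case False
    then have "g x = 0" "h x = 0" "f 0 = 0"
      using End_dsum_outside assms(2,3) End_dsum_zero[OF assms(1)] by blast+
    then show ?thesis by simp
  qed
qed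

lemma comp_scale_right:
  assumes "f \<in> End_dsum I P" "g \<in> End_dsum I P"
  shows "f \<circ> End_scale sP c g = End_scale sP c (f \<circ> g)"
proof
  fix x show "(f \<circ> End_scale sP c g) x = End_scale sP c (f \<circ> g) x"
  proof (cases "x \<in> D")
    case True
    then show ?thesis
      using End_dsum_scale[OF assms(1) End_dsum_closed[OF assms(2) True], of c]
      by (simp add: pointwise_def[of "pointwise sP"])
  next
    case False
    then have "g x = 0" "f 0 = 0"
      using End_dsum_outside[OF assms(2)] End_dsum_zero[OF assms(1)] by blast+
    moreover have "pointwise sP c 0 = (0 :: 'l \<Rightarrow> 'p)"
      by (simp add: pointwise_def fun_eq_iff)
    ultimately show ?thesis
      by (simp add: pointwise_def[of "pointwise sP"])
  qed
qed

lemma comp_scale_left: "End_scale sP c f \<circ> g = End_scale sP c (f \<circ> g)"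
  by (simp add: pointwise_def fun_eq_iff)

section \<open>Homogeneous blocks: composition and independence\<close>

lemma subspace_graded_Hom:
  assumes "l \<in> I" "m \<in> I"
  shows "module.subspace (pointwise sP) (graded_Hom (P l) (P m) j)"
proof -
  interpret L: graded_module sA A sP "P l" by (rule graded_module[OF assms(1)])
  interpret M: graded_module sA A sP "P m" by (rule graded_module[OF assms(2)])
  interpret W: vector_space "pointwise sP :: _ \<Rightarrow> ('p \<Rightarrow> _) \<Rightarrow> _"
    by (intro vector_space_pointwise) unfold_locales
  note sub = M.subspace_carrier M.subspace_gr
  show ?thesis
  proof (rule W.subspaceI)
    \<comment> \<open>Compatibility of the zero map with the action needs \<open>a\<close> to fix 0,
      which follows from scaling by 0.\<close>
    have "0 = act (P m) a 0" for a
      using M.act_scale_right[of 0 a 0] sub subspace_0 by auto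
    then show "0 \<in> graded_Hom (P l) (P m) j"
      using sub subspace_0 by (auto simp: graded_Hom_def module_Hom_def)
  next
    fix f g assume "f \<in> graded_Hom (P l) (P m) j" "g \<in> graded_Hom (P l) (P m) j"
    then show "f + g \<in> graded_Hom (P l) (P m) j"
      using sub subspace_add M.act_add_right
      by (auto simp: graded_Hom_def module_Hom_def image_subset_iff algebra_simps)
  next
    fix c f assume "f \<in> graded_Hom (P l) (P m) j"
    then show "pointwise sP c f \<in> graded_Hom (P l) (P m) j"
      using sub subspace_scale M.act_scale_right
      by (auto simp: graded_Hom_def module_Hom_def image_subset_iff algebra_simps pointwise_def)
  qed
qed

text \<open>\<open>block I P l m\<close> is linear, hence maps the subspace of homomorphisms of
  degree \<open>j\<close> onto a subspace.\<close>

lemma subspace_Hom_block_deg: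
  assumes "l \<in> I" "m \<in> I"
  shows "E.subspace (H l m j)"
proof -
  interpret W: vector_space "pointwise sP :: _ \<Rightarrow> ('p \<Rightarrow> _) \<Rightarrow> _"
    by (intro vector_space_pointwise) unfold_locales
  note sub = subspace_graded_Hom[OF assms, of j]
  show ?thesis unfolding Hom_block_deg_def
  proof (rule E.subspaceI)
    have "0 = block I P l m 0" by (simp add: block_def fun_eq_iff)
    then show "0 \<in> block I P l m ` graded_Hom (P l) (P m) j"
      using W.subspace_0[OF sub] by blast
  next
    fix x y assume "x \<in> block I P l m ` graded_Hom (P l) (P m) j" "y \<in> block I P l m ` graded_Hom (P l) (P m) j"
    then obtain f g where "f \<in> graded_Hom (P l) (P m) j" "g \<in> graded_Hom (P l) (P m) j"
      "x = block I P l m f" "y = block I P l m g" by blast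
    moreover have "block I P l m f + block I P l m g = block I P l m (f + g)"
      by (auto simp: block_def fun_eq_iff)
    ultimately show "x + y \<in> block I P l m ` graded_Hom (P l) (P m) j"
      using W.subspace_add[OF sub] by blast
  next
    fix c x assume "x \<in> block I P l m ` graded_Hom (P l) (P m) j"
    then obtain f where "f \<in> graded_Hom (P l) (P m) j" "x = block I P l m f" by blast
    moreover have "End_scale sP c (block I P l m f) = block I P l m (pointwise sP c f)"
      by (auto simp: block_def fun_eq_iff pointwise_def)
    ultimately show "End_scale sP c x \<in> block I P l m ` graded_Hom (P l) (P m) j"
      using W.subspace_scale[OF sub] by blast
  qed
qed

text \<open>Values of \<open>g\<close> are supported in the summand \<open>m'\<close>, while
  \<open>f\<close> reads only the coordinate \<open>l\<close>, where they are 0.\<close>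

lemma Hom_block_deg_comp_neq:
  assumes "f \<in> H l m j" "g \<in> H l' m' i" "m' \<noteq> l" "l \<in> I"
  shows "f \<circ> g = 0"
proof -
  obtain f' where f': "f' \<in> graded_Hom (P l) (P m) j" "f = block I P l m f'"
    using assms(1) unfolding Hom_block_deg_def by blast
  have "f' 0 = 0"
    by (rule graded_Hom_zero[OF f'(1) assms(4)])
  then show ?thesis
    using assms(2,3) f' unfolding Hom_block_deg_def by (auto simp: block_def fun_eq_iff)
qed

lemma Hom_block_deg_comp:
  assumes "f \<in> H l m j" "g \<in> H l' l i" "l \<in> I" "l' \<in> I"
  shows "f \<circ> g \<in> H l' m (i + j)"
proof -
  obtain f' where f': "f' \<in> graded_Hom (P l) (P m) j" "f = block I P l m f'"
    using assms(1) unfolding Hom_block_deg_def by blast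
  obtain g' where g': "g' \<in> graded_Hom (P l') (P l) i" "g = block I P l' l g'"
    using assms(2) unfolding Hom_block_deg_def by blast
  have f0: "f' 0 = 0"
    by (rule graded_Hom_zero[OF f'(1) assms(3)])
  \<comment> \<open>\<open>block\<close> returns 0 off \<open>D\<close>, so the intermediate vector
    must be seen to lie in \<open>D\<close> before the two blocks can be fused.\<close>
  have "block I P l' l g' x \<in> D" if "x \<in> D" for x
  proof -
    have "block I P l' l g' x = single l (g' (x l'))" using that by (auto simp: block_def)
    moreover have "g' (x l') \<in> carrier (P l)"
      using g' in_dsumD[OF that assms(4)] by (simp add: graded_Hom_def module_Hom_def)
    ultimately show ?thesis using single_in_dsum[OF assms(3)] by simp
  qed
  then have "f \<circ> g = block I P l' m (f' \<circ> g')"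
    unfolding f' g' using f0 by (auto simp: fun_eq_iff block_def)
  moreover have "f' \<circ> g' \<in> graded_Hom (P l') (P m) (i + j)"
    using f' g' f0 by (fastforce simp: graded_Hom_def module_Hom_def image_subset_iff algebra_simps)
  ultimately show ?thesis unfolding Hom_block_deg_def by blast
qed

text \<open>Apply both sides to \<open>single l y\<close> with \<open>y\<close> of degree
  \<open>k\<close>, and take the part of degree \<open>k + j\<close> of the coordinate
  \<open>m\<close>. Nothing of \<open>h t\<close> survives: another source gives the argument 0,
  another target a zero coordinate, another degree a value outside degree \<open>k + j\<close>. Thus
  the sum of the pieces \<open>H l m j\<close> is direct.\<close>

lemma Hom_block_deg_eq_0_if_sum:
  assumes "l \<in> I" "m \<in> I" and w: "w \<in> H l m j"
    and T: "\<And>t. t \<in> T \<Longrightarrow> \<exists>l'\<in>I. \<exists>m'\<in>I. \<exists>j'. (l', m', j') \<noteq> (l, m, j) \<and> h t \<in> H l' m' j'"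
    and w_eq: "w = (\<Sum>t\<in>T. h t)"
  shows "w = 0"
proof -
  interpret L: graded_module sA A sP "P l" by (rule graded_module[OF assms(1)])
  interpret M: graded_module sA A sP "P m" by (rule graded_module[OF assms(2)])
  obtain f where f: "f \<in> graded_Hom (P l) (P m) j" and wf: "w = block I P l m f"
    using w unfolding Hom_block_deg_def by blast
  have "f = 0"
  proof (rule L.module_Hom_eq_0_if_gr)
    show "f \<in> module_Hom (P l) (P m)" using f by (simp add: graded_Hom_def)
    fix k y assume y: "y \<in> gr (P l) k"
    then have yc: "y \<in> carrier (P l)" using L.gr_subset by blast
    have val: "h t (single l y) m \<in> carrier (P m) \<and>
        M.homogeneous_components (h t (single l y) m) (k + j) = 0" if t: "t \<in> T" for t
    proof -
      have "0 \<in> carrier (P m) \<and> M.homogeneous_components 0 (k + j) = 0"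
        using M.homogeneous_components_homogeneous[of 0 0] subspace_0 M.subspace_gr M.subspace_carrier
        by auto
      note zero = this[THEN conjunct1] this[THEN conjunct2]
      obtain l' m' j' where *: "l' \<in> I" "m' \<in> I" "(l', m', j') \<noteq> (l, m, j)" "h t \<in> H l' m' j'"
        using T[OF t] by blast
      then obtain g where g: "g \<in> graded_Hom (P l') (P m') j'" "h t = block I P l' m' g"
        unfolding Hom_block_deg_def by blast
      have g0: "g 0 = 0"
        by (rule graded_Hom_zero[OF g(1) *(1)])
      have eq: "h t (single l y) m = (if m = m' then g (single l y l') else 0)"
        using g single_in_dsum[OF assms(1) yc] by (simp add: block_def)
      show ?thesis
      proof (cases "m' = m \<and> l' = l")
        case True
        then have "j' \<noteq> j" using * by simp
        have "g y \<in> gr (P m) (k + j')" using g y True by (auto simp: graded_Hom_def)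
        then show ?thesis
          using M.homogeneous_components_homogeneous[of "g y" "k + j'" "k + j"] M.gr_subset \<open>j' \<noteq> j\<close> eq True
          by auto
      next
        case False
        then have "h t (single l y) m = 0" using eq g0 by auto
        then show ?thesis using zero by simp
      qed
    qed
    have "f y = w (single l y) m"
      using single_in_dsum[OF assms(1) yc] by (simp add: wf block_def)
    also have "\<dots> = (\<Sum>t\<in>T. h t (single l y) m)"
      by (simp add: w_eq sum_fun_apply)
    finally have "M.homogeneous_components (f y) (k + j) = 0"
      using val by (simp add: M.homogeneous_components_sum)
    moreover have "f y \<in> gr (P m) (k + j)" using f y by (auto simp: graded_Hom_def)
    ultimately show "f y = 0" using M.homogeneous_components_homogeneous by simp
  qed
  then show ?thesis by (auto simp: wf block_def fun_eq_iff)
qed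

text \<open>Were the triples different, the one-term sum over \<open>{w}\<close> would exhibit
  \<open>w\<close> as a sum of elements of other pieces.\<close>

lemma Hom_block_deg_unique:
  assumes "l \<in> I" "m \<in> I" "w \<in> H l m j" "l' \<in> I" "m' \<in> I" "w \<in> H l' m' j'" "w \<noteq> 0"
  shows "l' = l \<and> m' = m \<and> j' = j"
  using Hom_block_deg_eq_0_if_sum[OF assms(1-3), of "{w}" "\<lambda>x. x"] assms(4-) by auto

end


section \<open>Admissible bases, partners and the degree of the socle maps\<close>

locale admissible_basis_family = graded_module_family sP sA A I P
  for sP :: "'k::field \<Rightarrow> 'p::ab_group_add \<Rightarrow> 'p"
    and sA :: "'k \<Rightarrow> 'a::ring_1 \<Rightarrow> 'a" and A :: "nat \<Rightarrow> 'a set"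
    and I :: "'l set" and P :: "'l \<Rightarrow> ('a, 'p) gmod" +
  fixes \<theta> :: "'l \<Rightarrow> 'p \<Rightarrow> 'p" and \<Upsilon> :: "(('l \<Rightarrow> 'p) \<Rightarrow> ('l \<Rightarrow> 'p)) set"
  assumes admissible: "admissible_basis sP I P \<theta> \<Upsilon>"
begin

abbreviation "deg l \<equiv> top_degree (P l)"
abbreviation "T \<equiv> \<Theta> I P \<theta>"
abbreviation "tr \<equiv> canonical_form sP I P \<theta> \<Upsilon>"
abbreviation "B \<equiv> End_dsum I P"

lemma appropriate: "appropriate_basis sP I P \<theta> \<Upsilon>"
  using admissible by (simp add: admissible_basis_def)

lemma independent_basis: "E.independent \<Upsilon>" and span_basis: "E.span \<Upsilon> = B"
  using appropriate by (simp_all add: appropriate_basis_def basis_of_def)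

lemma basis_subset: "\<Upsilon> \<subseteq> B"
  using E.span_superset span_basis by auto

lemma basis_homogeneousE:
  assumes "u \<in> \<Upsilon>" obtains l m j where "l \<in> I" "m \<in> I" "u \<in> H l m j"
proof -
  have "\<Upsilon> \<subseteq> (\<Union>l\<in>I. \<Union>m\<in>I. \<Union>j. H l m j)"
    using admissible unfolding admissible_basis_def by (elim conjE)
  then show ?thesis using assms that by blast
qed

lemma T_in_basis: "l \<in> I \<Longrightarrow> T l \<in> \<Upsilon>"
  using appropriate by (auto simp: appropriate_basis_def)

lemma basis_neq_0: "u \<in> \<Upsilon> \<Longrightarrow> u \<noteq> 0"
  using independent_basis E.dependent_zero by blast

lemma basis_representationE:
  assumes "x \<in> B"
  obtains S c where "finite S" "S \<subseteq> \<Upsilon>" "x = (\<Sum>u\<in>S. End_scale sP (c u) u)"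
proof -
  have "x \<in> {\<Sum>u\<in>S. End_scale sP (c u) u |S c. finite S \<and> S \<subseteq> \<Upsilon>}"
    using assms E.span_explicit[of \<Upsilon>] span_basis by simp
  then show ?thesis using that by blast
qed

interpretation tr: Vector_Spaces.linear "End_scale sP" "(*)" tr
  by (rule canonical_form_linear[OF _ appropriate]) unfold_locales

lemmas tr_add = tr.add and tr_scale = tr.scale and tr_sum = tr.sum and tr_zero = tr.zero

lemma tr_basis: "u \<in> \<Upsilon> \<Longrightarrow> tr u = (if u \<in> T ` I then 1 else 0)"
  by (rule canonical_form_on_basis[OF _ appropriate]) unfold_locales

lemma tr_T: "l \<in> I \<Longrightarrow> tr (T l) = 1"
  using tr_basis T_in_basis by auto

text \<open>\<open>f\<close> itself witnesses that its piece meets \<open>\<Upsilon>\<close>, which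
  unlocks the admissibility conditions for the triple \<open>l\<close>, \<open>m\<close>,
  \<open>j\<close>.\<close>

lemma admissible_partner:
  assumes "l \<in> I" "m \<in> I" "f \<in> \<Upsilon>" "f \<in> H l m j"
  shows "deg m = deg l"
    and "\<exists>!g. g \<in> \<Upsilon> \<inter> H m l (deg l - j) \<and>
      (\<exists>c. c \<noteq> 0 \<and> g \<circ> f = End_scale sP c (T l) \<and> f \<circ> g = End_scale sP c (T m)) \<and>
      (\<forall>h \<in> \<Upsilon> \<inter> H m l (deg l - j). h \<noteq> g \<longrightarrow> h \<circ> f = 0 \<and> f \<circ> h = 0)"
proof -
  have f: "f \<in> \<Upsilon> \<inter> H l m j" using assms by simp
  then have "\<Upsilon> \<inter> H l m j \<noteq> {}" by (rule ex_in_conv[THEN iffD1, OF exI])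
  note * = admissible[unfolded admissible_basis_def, THEN conjunct2, THEN conjunct2,
      THEN bspec, OF assms(1), THEN bspec, OF assms(2), THEN spec, THEN mp, OF this]
  show "deg m = deg l" by (rule *[THEN conjunct1])
  show "\<exists>!g. g \<in> \<Upsilon> \<inter> H m l (deg l - j) \<and>
      (\<exists>c. c \<noteq> 0 \<and> g \<circ> f = End_scale sP c (T l) \<and> f \<circ> g = End_scale sP c (T m)) \<and>
      (\<forall>h \<in> \<Upsilon> \<inter> H m l (deg l - j). h \<noteq> g \<longrightarrow> h \<circ> f = 0 \<and> f \<circ> h = 0)"
    by (rule *[THEN conjunct2, THEN conjunct2, THEN bspec, OF f])
qed

lemmas deg_eq = admissible_partner(1)

lemma partnerE:
  assumes "l \<in> I" "m \<in> I" "f \<in> \<Upsilon>" "f \<in> H l m j"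
  obtains g c where "g \<in> \<Upsilon>" "g \<in> H m l (deg l - j)" "c \<noteq> 0"
    "g \<circ> f = End_scale sP c (T l)" "f \<circ> g = End_scale sP c (T m)"
    "\<forall>h \<in> \<Upsilon> \<inter> H m l (deg l - j). h \<noteq> g \<longrightarrow> h \<circ> f = 0 \<and> f \<circ> h = 0"
proof -
  obtain g where g: "g \<in> \<Upsilon> \<inter> H m l (deg l - j) \<and>
      (\<exists>c. c \<noteq> 0 \<and> g \<circ> f = End_scale sP c (T l) \<and> f \<circ> g = End_scale sP c (T m)) \<and>
      (\<forall>h \<in> \<Upsilon> \<inter> H m l (deg l - j). h \<noteq> g \<longrightarrow> h \<circ> f = 0 \<and> f \<circ> h = 0)"
    using ex1_implies_ex[OF admissible_partner(2)[OF assms]] by (rule exE)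
  obtain c where c: "c \<noteq> 0 \<and> g \<circ> f = End_scale sP c (T l) \<and> f \<circ> g = End_scale sP c (T m)"
    using g[THEN conjunct2, THEN conjunct1] by (rule exE)
  show ?thesis
  proof (rule that)
    show "g \<in> \<Upsilon>" "g \<in> H m l (deg l - j)" using g[THEN conjunct1] by simp_all
    show "c \<noteq> 0" "g \<circ> f = End_scale sP c (T l)" "f \<circ> g = End_scale sP c (T m)"
      using c by simp_all
    show "\<forall>h \<in> \<Upsilon> \<inter> H m l (deg l - j). h \<noteq> g \<longrightarrow> h \<circ> f = 0 \<and> f \<circ> h = 0"
      by (rule g[THEN conjunct2, THEN conjunct2])
  qed
qed

lemma T_homogeneous:
  assumes n: "n \<in> I" shows "T n \<in> H n n (deg n)"
proof -
  obtain l m j where *: "l \<in> I" "m \<in> I" "T n \<in> H l m j"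
    using basis_homogeneousE[OF T_in_basis[OF n]] .
  then obtain f where f: "f \<in> graded_Hom (P l) (P m) j" "T n = block I P l m f"
    unfolding Hom_block_deg_def by blast
  have f0: "f 0 = 0"
    by (rule graded_Hom_zero[OF f(1) *(1)])
  \<comment> \<open>\<open>T n\<close> sees only the coordinate \<open>n\<close> of its argument.
    Hence it is still nonzero on \<open>single n (x n)\<close>, with value in the summand
    \<open>n\<close>, which rules out every block except the one from \<open>n\<close> to
    \<open>n\<close>.\<close>
  obtain x i where "T n x i \<noteq> 0"
    using basis_neq_0[OF T_in_basis[OF n]] by (auto simp: fun_eq_iff)
  then have x: "x \<in> D" "\<theta> n (x n) \<noteq> 0" by (auto simp: block_def split: if_splits)
  have single: "single n (x n) \<in> D" by (rule single_in_dsum[OF n in_dsumD[OF x(1) n]])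
  then have "\<theta> n (x n) = T n (single n (x n)) n" by (simp add: block_def)
  also have "\<dots> = (if n = m then f (single n (x n) l) else 0)"
    unfolding f(2) using single by (simp add: block_def)
  finally have lm: "l = n" "m = n" using x(2) f0 by (auto split: if_splits)
  then have Tj: "T n \<in> H n n j" using * by simp
  \<comment> \<open>The degree of \<open>c\<close> times \<open>T n\<close> is computed twice: as
    the product \<open>g \<circ> T n\<close> it is \<open>deg n\<close>, as a multiple of
    \<open>T n\<close> it is \<open>j\<close>.\<close>
  obtain g c where g: "g \<in> H n n (deg n - j)" and c: "c \<noteq> 0"
    and eq: "g \<circ> T n = End_scale sP c (T n)"
    using partnerE[OF n n T_in_basis[OF n] Tj] by metis
  have "End_scale sP c (T n) \<in> H n n (deg n)"
    using Hom_block_deg_comp[OF g Tj n n] eq by simp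
  moreover have "End_scale sP c (T n) \<in> H n n j"
    using E.subspace_scale[OF subspace_Hom_block_deg] Tj n by blast
  moreover have "End_scale sP c (T n) \<noteq> 0"
    using c basis_neq_0[OF T_in_basis[OF n]] by (simp add: E.scale_eq_0_iff)
  ultimately have "j = deg n" using Hom_block_deg_unique n by blast
  then show ?thesis using Tj by simp
qed

section \<open>The trace on homogeneous elements and their products\<close>

text \<open>Only basis elements in the piece \<open>H l m j\<close> contribute to \<open>x\<close>.
  Under \<open>neq\<close> none of them is some \<open>T n\<close>, because that element lives in
  \<open>H n n (deg n)\<close>.\<close>

lemma tr_homogeneous_eq_0:
  assumes "l \<in> I" "m \<in> I" "x \<in> H l m j" "x \<in> B" and neq: "l \<noteq> m \<or> j \<noteq> deg l"
  shows "tr x = 0"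
proof -
  obtain S c where S: "finite S" "S \<subseteq> \<Upsilon>" and x: "x = (\<Sum>u\<in>S. End_scale sP (c u) u)"
    using basis_representationE[OF assms(4)] .
  let ?S = "S \<inter> H l m j" and ?f = "\<lambda>u. End_scale sP (c u) u"
  note sub = subspace_Hom_block_deg
  have split: "x = sum ?f ?S + sum ?f (S - H l m j)"
    using S(1) unfolding x by (subst sum.Int_Diff[of S _ "H l m j"]) auto
  have "sum ?f ?S \<in> H l m j"
    by (intro E.subspace_sum sub assms E.subspace_scale) auto
  \<comment> \<open>The difference lies in \<open>H l m j\<close> and is at the same time the sum of
    the terms from other pieces, so it vanishes.\<close>
  then have "x - sum ?f ?S \<in> H l m j"
    using E.subspace_diff[OF sub] assms by blast
  then have "x - sum ?f ?S = 0"
  proof (rule Hom_block_deg_eq_0_if_sum[OF assms(1,2), where h = ?f and T = "S - H l m j"])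
    fix u assume u: "u \<in> S - H l m j"
    then obtain l' m' j' where "l' \<in> I" "m' \<in> I" "u \<in> H l' m' j'"
      using S basis_homogeneousE by blast
    moreover from this u have "(l', m', j') \<noteq> (l, m, j)" by auto
    ultimately show "\<exists>l'\<in>I. \<exists>m'\<in>I. \<exists>j'. (l', m', j') \<noteq> (l, m, j) \<and> ?f u \<in> H l' m' j'"
      using E.subspace_scale[OF sub, of l' m' u j' "c u"] by blast
  qed (use split in \<open>simp add: algebra_simps\<close>)
  then have "tr x = (\<Sum>u\<in>?S. c u * tr u)"
    by (simp add: tr_sum tr_scale)
  also have "\<dots> = 0"
  proof (intro sum.neutral ballI)
    fix u assume u: "u \<in> ?S"
    then have "u \<in> \<Upsilon>" using S by blast
    moreover have "u \<notin> T ` I"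
    proof
      assume "u \<in> T ` I"
      then obtain n where n: "n \<in> I" "u = T n" by blast
      then show False
        using Hom_block_deg_unique[OF assms(1,2), of u j n n "deg n"] u T_homogeneous[OF n(1)]
          basis_neq_0[OF \<open>u \<in> \<Upsilon>\<close>] neq by auto
    qed
    ultimately show "c u * tr u = 0" by (simp add: tr_basis)
  qed
  finally show ?thesis .
qed

text \<open>A nonzero product goes from \<open>l'\<close> to \<open>m\<close> in degree
  \<open>i + j\<close>, so a nonzero trace forces \<open>l' = m\<close> and
  \<open>i + j = deg m\<close>. The complementary degree is therefore stated with
  \<open>deg m\<close>; for a basis element \<open>f\<close> it agrees with the \<open>deg l\<close>
  of the partner condition by \<open>deg_eq\<close>.\<close>

lemma tr_comp_eq_0:
  assumes "l \<in> I" "m \<in> I" "l' \<in> I" "m' \<in> I" "f \<in> H l m j" "g \<in> H l' m' i"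
    and "f \<in> B" "g \<in> B" "(l', m', i) \<noteq> (m, l, deg m - j)"
  shows "tr (f \<circ> g) = 0"
proof (cases "m' = l")
  case True
  then have "f \<circ> g \<in> H l' m (i + j)"
    using Hom_block_deg_comp assms by blast
  then show ?thesis
    using assms True End_dsum_comp by (intro tr_homogeneous_eq_0[of l' m _ "i + j"]) auto
next
  case False
  then show ?thesis using Hom_block_deg_comp_neq[OF assms(5,6)] assms(1) tr_zero by simp
qed

section \<open>Symmetry of the form\<close>

lemma tr_comp_commute_basis:
  assumes "f \<in> \<Upsilon>" "g \<in> \<Upsilon>"
  shows "tr (f \<circ> g) = tr (g \<circ> f)"
proof -
  obtain l m j where f: "l \<in> I" "m \<in> I" "f \<in> H l m j" using basis_homogeneousE assms(1) .
  obtain l' m' i where g: "l' \<in> I" "m' \<in> I" "g \<in> H l' m' i" using basis_homogeneousE assms(2) .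
  have deg: "deg m = deg l" by (rule deg_eq[OF f(1,2) assms(1) f(3)])
  have inB: "f \<in> B" "g \<in> B" using assms basis_subset by blast+
  show ?thesis
  proof (cases "(l', m', i) = (m, l, deg l - j)")
    case True
    obtain p c where "p \<in> \<Upsilon>" "p \<in> H m l (deg l - j)" "c \<noteq> 0"
      and p: "p \<circ> f = End_scale sP c (T l)" "f \<circ> p = End_scale sP c (T m)"
      "\<forall>h \<in> \<Upsilon> \<inter> H m l (deg l - j). h \<noteq> p \<longrightarrow> h \<circ> f = 0 \<and> f \<circ> h = 0"
      using partnerE[OF f(1,2) assms(1) f(3)] .
    show ?thesis
    proof (cases "g = p")
      \<comment> \<open>The two products carry the same scalar \<open>c\<close>, and both
        \<open>T l\<close> and \<open>T m\<close> have trace 1.\<close>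
      case True
      then show ?thesis unfolding p(1)[folded True] p(2)[folded True] tr_scale tr_T[OF f(1)] tr_T[OF f(2)] by simp
    next
      case False
      have "g \<in> H m l (deg l - j)" using True g(3) by simp
      then have "g \<circ> f = 0" "f \<circ> g = 0" using p(3)[THEN bspec, OF IntI, OF assms(2), THEN mp, OF _ False] by blast+
      then show ?thesis by (simp only:)
    qed
  next
    case False
    then have "tr (f \<circ> g) = 0"
      using deg by (intro tr_comp_eq_0[OF f(1,2) g(1,2) f(3) g(3) inB]) simp
    \<comment> \<open>Being complementary is symmetric in \<open>f\<close> and \<open>g\<close>: for
      \<open>m' = l\<close>, the equation \<open>i = deg l - j\<close> is the same as
      \<open>j = deg m' - i\<close>.\<close>
    moreover have "(l, m, j) \<noteq> (m', l', deg m' - i)"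
      using False deg deg_eq[OF g(1,2) assms(2) g(3)] by auto
    then have "tr (g \<circ> f) = 0"
      by (rule tr_comp_eq_0[OF g(1,2) f(1,2) g(3) f(3) inB(2,1)])
    ultimately show ?thesis by simp
  qed
qed

lemma subspace_B: "E.subspace B"
  unfolding span_basis[symmetric] by (rule E.subspace_span)

lemma comp_add_left: "(f + g) \<circ> h = (f \<circ> h) + (g \<circ> h)"
  by (simp add: fun_eq_iff)

text \<open>The condition is linear in \<open>f\<close>, so \<open>span_minimal\<close> can extend
  it from \<open>\<Upsilon>\<close> to \<open>B\<close>.\<close>

lemma subspace_commute:
  assumes "g \<in> B"
  shows "E.subspace {f \<in> B. tr (f \<circ> g) = tr (g \<circ> f)}"
proof (rule E.subspaceI)
  have "(0 :: ('l \<Rightarrow> 'p) \<Rightarrow> 'l \<Rightarrow> 'p) \<circ> g = 0" by (simp add: fun_eq_iff)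
  moreover have "g \<circ> (0 :: ('l \<Rightarrow> 'p) \<Rightarrow> 'l \<Rightarrow> 'p) = 0" using End_dsum_zero[OF assms] by (simp add: fun_eq_iff)
  ultimately show "0 \<in> {f \<in> B. tr (f \<circ> g) = tr (g \<circ> f)}"
    using E.subspace_0[OF subspace_B] by simp
next
  fix x y assume "x \<in> {f \<in> B. tr (f \<circ> g) = tr (g \<circ> f)}" "y \<in> {f \<in> B. tr (f \<circ> g) = tr (g \<circ> f)}"
  then show "x + y \<in> {f \<in> B. tr (f \<circ> g) = tr (g \<circ> f)}"
    using assms by (simp add: E.subspace_add[OF subspace_B] comp_add_right comp_add_left tr_add)
next
  fix c x assume "x \<in> {f \<in> B. tr (f \<circ> g) = tr (g \<circ> f)}"
  then show "End_scale sP c x \<in> {f \<in> B. tr (f \<circ> g) = tr (g \<circ> f)}"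
    using assms by (simp add: E.subspace_scale[OF subspace_B] comp_scale_right comp_scale_left tr_scale)
qed

lemma tr_comp_commute:
  assumes "f \<in> B" "g \<in> B"
  shows "tr (f \<circ> g) = tr (g \<circ> f)"
proof -
  \<comment> \<open>Bilinear extension takes two passes; in the first, one factor stays in the
    basis.\<close>
  have basis: "tr (f \<circ> u) = tr (u \<circ> f)" if "f \<in> B" "u \<in> \<Upsilon>" for f u
  proof -
    have "E.span \<Upsilon> \<subseteq> {f \<in> B. tr (f \<circ> u) = tr (u \<circ> f)}"
      using that basis_subset tr_comp_commute_basis by (intro E.span_minimal subspace_commute) auto
    then show ?thesis using that span_basis by auto
  qed
  \<comment> \<open>The second pass fixes an arbitrary \<open>f\<close> and frees the factor that
    was in the basis.\<close>
  have "E.span \<Upsilon> \<subseteq> {h \<in> B. tr (h \<circ> f) = tr (f \<circ> h)}"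
    using assms basis_subset basis by (intro E.span_minimal subspace_commute) auto
  then show ?thesis using assms span_basis by auto
qed

section \<open>Non-degeneracy of the form\<close>

text \<open>The partner \<open>g\<close> of \<open>u\<close> is dual to \<open>u\<close> up to a
  scalar: basis elements outside the piece of \<open>u\<close> are killed by
  \<open>tr_comp_eq_0\<close>, the others in that piece by the partner condition.\<close>

lemma dual_basis_elementE:
  assumes u: "u \<in> \<Upsilon>"
  obtains g where "g \<in> B" "tr (u \<circ> g) \<noteq> 0" "\<forall>v\<in>\<Upsilon>. v \<noteq> u \<longrightarrow> tr (v \<circ> g) = 0"
proof -
  obtain l m j where lm: "l \<in> I" "m \<in> I" "u \<in> H l m j" using basis_homogeneousE u .
  have deg: "deg m = deg l" by (rule deg_eq[OF lm(1,2) u lm(3)])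
  obtain g c where g: "g \<in> \<Upsilon>" "g \<in> H m l (deg l - j)" "c \<noteq> 0"
    and "g \<circ> u = End_scale sP c (T l)" and ug_T: "u \<circ> g = End_scale sP c (T m)"
    using partnerE[OF lm(1,2) u lm(3)] .
  have ug: "tr (u \<circ> g) = c" unfolding ug_T tr_scale tr_T[OF lm(2)] by simp
  \<comment> \<open>The condition at \<open>u\<close> controls products with \<open>u\<close>, but
    products \<open>v \<circ> g\<close> are wanted. So it is applied to \<open>g\<close> as well,
    whose partner \<open>p\<close> must then be identified with \<open>u\<close>.\<close>
  obtain p d where "p \<in> \<Upsilon>" "p \<in> H l m (deg m - (deg l - j))" "d \<noteq> 0"
    "p \<circ> g = End_scale sP d (T m)" "g \<circ> p = End_scale sP d (T l)"
    and p: "\<forall>h \<in> \<Upsilon> \<inter> H l m (deg m - (deg l - j)). h \<noteq> p \<longrightarrow> h \<circ> g = 0 \<and> g \<circ> h = 0"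
    using partnerE[OF lm(2,1) g(1,2)] .
  have "deg m - (deg l - j) = j" using deg by simp
  note p = p[unfolded this, THEN bspec, OF IntI, THEN mp, THEN conjunct1]
  \<comment> \<open>Otherwise the condition at \<open>g\<close> would give
    \<open>u \<circ> g = 0\<close>, although its trace is \<open>c\<close>.\<close>
  have "p = u"
  proof (rule ccontr)
    assume "p \<noteq> u"
    then have "u \<circ> g = 0" using p[OF u lm(3)] by blast
    then show False using ug g(3) tr_zero by simp
  qed
  have "tr (v \<circ> g) = 0" if v: "v \<in> \<Upsilon>" "v \<noteq> u" for v
  proof -
    obtain a b i where ab: "a \<in> I" "b \<in> I" "v \<in> H a b i" using basis_homogeneousE v(1) .
    show ?thesis
    proof (cases "(a, b, i) = (l, m, j)")
      case True
      then have "v \<circ> g = 0" using p[of v] v ab(3) \<open>p = u\<close> by simp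
      then show ?thesis using tr_zero by simp
    next
      case False
      then have "(m, l, deg l - j) \<noteq> (b, a, deg b - i)" using deg by auto
      moreover have "v \<in> B" "g \<in> B" using v(1) g(1) basis_subset by blast+
      ultimately show ?thesis using tr_comp_eq_0[OF ab(1,2) lm(2,1) ab(3) g(2)] by blast
    qed
  qed
  moreover have "g \<in> B" using g(1) basis_subset by blast
  ultimately show ?thesis using that[of g] g(3) ug by blast
qed

text \<open>Pairing \<open>f\<close> with the element dual to \<open>u\<close> extracts the
  coefficient \<open>c u\<close> up to a nonzero factor.\<close>

lemma tr_nondegenerate:
  assumes "f \<in> B" and zero: "\<And>g. g \<in> B \<Longrightarrow> tr (f \<circ> g) = 0"
  shows "f = 0"
proof -
  obtain S c where S: "finite S" "S \<subseteq> \<Upsilon>" and f: "f = (\<Sum>u\<in>S. End_scale sP (c u) u)"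
    using basis_representationE[OF assms(1)] .
  have "c u = 0" if "u \<in> S" for u
  proof -
    obtain g where g: "g \<in> B" "tr (u \<circ> g) \<noteq> 0" "\<forall>v\<in>\<Upsilon>. v \<noteq> u \<longrightarrow> tr (v \<circ> g) = 0"
      using dual_basis_elementE[OF subsetD[OF S(2) \<open>u \<in> S\<close>]] .
    have "f \<circ> g = (\<Sum>v\<in>S. End_scale sP (c v) (v \<circ> g))"
      unfolding f by (simp add: fun_eq_iff sum_fun_apply pointwise_def)
    then have "tr (f \<circ> g) = (\<Sum>v\<in>S. c v * tr (v \<circ> g))"
      by (simp add: tr_sum tr_scale)
    also have "\<dots> = (\<Sum>v\<in>S. if v = u then c u * tr (u \<circ> g) else 0)"
    proof (rule sum.cong[OF refl])
      fix v assume "v \<in> S"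
      then have "v \<in> \<Upsilon>" using S(2) by blast
      then show "c v * tr (v \<circ> g) = (if v = u then c u * tr (u \<circ> g) else 0)"
        using g(3) by (cases "v = u") simp_all
    qed
    also have "\<dots> = c u * tr (u \<circ> g)" using S \<open>u \<in> S\<close> by simp
    finally show ?thesis using zero[OF g(1)] g(2) by simp
  qed
  then show ?thesis unfolding f by (simp add: sum.neutral)
qed

lemma symmetrizing_form_tr: "symmetrizing_form (End_scale sP) B (\<circ>) tr"
  unfolding symmetrizing_form_def
proof (intro conjI ballI allI impI)
  \<comment> \<open>By symmetry of the form, an element of the right radical lies in the left
    radical.\<close>
  fix g assume "g \<in> B" "\<forall>f\<in>B. tr (f \<circ> g) = 0"
  then show "g = 0" by (intro tr_nondegenerate) (simp_all add: tr_comp_commute[of g])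
qed (simp_all add: tr_add tr_scale tr_comp_commute tr_nondegenerate)

end

section \<open>Specialization to the indecomposable projective-injective modules\<close>

theorem proposition3p9:
  fixes sA :: "'k::alg_closed_field \<Rightarrow> 'a::ring_1 \<Rightarrow> 'a"
    and A :: "nat \<Rightarrow> 'a set"
    and \<Lambda> :: "'l set"
    and sL :: "'k \<Rightarrow> 'q::ab_group_add \<Rightarrow> 'q"
    and L :: "'l \<Rightarrow> ('a, 'q) gmod"
    and sP :: "'k \<Rightarrow> 'p::ab_group_add \<Rightarrow> 'p"
    and P :: "'l \<Rightarrow> ('a, 'p) gmod"
    and \<theta> :: "'l \<Rightarrow> 'p \<Rightarrow> 'p"
    and \<Upsilon> :: "(('l \<Rightarrow> 'p) \<Rightarrow> ('l \<Rightarrow> 'p)) set"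
  defines "\<Lambda>0 \<equiv> injective_indices sA \<Lambda> P"
  defines "B \<equiv> End_dsum \<Lambda>0 P"
  assumes "positively_graded_algebra sA A"
    and "\<forall>l\<in>\<Lambda>. graded_module sA A sL (L l) \<and> concentrated_in_degree_0 (L l)"
    and "complete_set_of_simples sA \<Lambda> L"
    and "\<forall>l\<in>\<Lambda>. graded_module sA A sP (P l) \<and> graded_projective_cover sA (P l) (L l)"
    and "\<Lambda>0 \<noteq> {}"
    and "\<forall>m\<in>\<Lambda>0. graded_iso (graded_soc sP (P m)) (shift (L m) (top_degree (P m)))"
    and "\<forall>l\<in>\<Lambda>0. \<theta> l \<in> module_Hom (P l) (P l) \<and> \<theta> l \<noteq> 0 \<and> \<theta> l ` carrier (P l) = soc sP (P l)"
    and "admissible_basis sP \<Lambda>0 P \<theta> \<Upsilon>"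
  shows "symmetrizing_form (End_scale sP) B (\<circ>) (canonical_form sP \<Lambda>0 P \<theta> \<Upsilon>)
    \<and> symmetric_algebra (End_scale sP) B (\<circ>)"
proof -
  \<comment> \<open>Non-emptiness supplies a graded module over \<open>sP\<close>, from which the
    vector space axioms for \<open>sP\<close> are read off.\<close>
  obtain l where l: "l \<in> \<Lambda>0" using assms(7) by blast
  have mem: "n \<in> \<Lambda>" if "n \<in> \<Lambda>0" for n
    using that by (simp add: \<Lambda>0_def injective_indices_def)
  have graded: "graded_module sA A sP (P n)" if "n \<in> \<Lambda>0" for n
    using bspec[OF assms(6) mem[OF that]] by (rule conjunct1)
  interpret P: graded_module sA A sP "P l" by (rule graded[OF l])
  interpret admissible_basis_family sP sA A \<Lambda>0 P \<theta> \<Upsilon>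
    by (intro admissible_basis_family.intro graded_module_family.intro
        graded_module_family_axioms.intro admissible_basis_family_axioms.intro
        P.V.vector_space_axioms graded assms(10))
  show ?thesis
    unfolding B_def symmetric_algebra_def
    by (intro conjI exI) (rule symmetrizing_form_tr)+
qed

end
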